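(* Let $n$ be a positive integer and let $c_1,\ldots,c_n$ be circles in the Euclidean plane such that, for each $i\in\{1,\ldots,n-1\}$, the pair $(c_i,c_{i+1})$ is kissing in a point $S_i$, and the pair $(c_n,c_1)$ is kissing in a point $S_n$. Let $P_1$ be a point on $c_1$, and construct points $P_2\in c_2,\ldots,P_n\in c_n$ successively such that, for each $i\in\{1,\ldots,n-1\}$, the point $P_{i+1}$ on $c_{i+1}$ is obtained by passing the point $P_i$ on $c_i$ through the kissing point $S_i$. Let $Q$ be the point on $c_1$ obtained by passing $P_n$ on $c_n$ through the kissing point $S_n$. Then the following two statements hold: (1) If $n$ is even, then $Q=P_1$. (2) If $n$ is odd, then the chord $\overline{QP_1}$ is a diameter of $c_1$.
   Context: Circles are circles in the Euclidean plane (of positive radius). Kissing circles: a pair of circles $c,c'$ is kissing in a point $S$ if (i) $c\cap c'=\{S\}$, and (ii) the circles $c$ and $c'$ lie on opposite sides of their common tangent in $S$. Passing through the kissing point: let $c$ and $c'$ be circles kissing in a point $S$, and let $P$ be a point on $c$. The point $P'$ on $c'$ obtained by passing $P$ through the kissing point $S$ is defined as follows: if $P=S$, then $P'=S$; if $P\neq S$, then $P'$ is the intersection point different from $S$ of the line $PS$ with $c'$. *)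

theory Defs
  imports "HOL-Analysis.Analysis"
begin

definition is_circle :: "(real^2) set \<Rightarrow> bool" where
  "is_circle c \<longleftrightarrow> (\<exists>a r. r > 0 \<and> c = sphere a r)"

definition is_line :: "(real^2) set \<Rightarrow> bool" where
  "is_line L \<longleftrightarrow> affine L \<and> aff_dim L = 1"

definition is_tangent :: "(real^2) set \<Rightarrow> (real^2) set \<Rightarrow> real^2 \<Rightarrow> bool" where
  "is_tangent L c S \<longleftrightarrow> is_line L \<and> L \<inter> c = {S}"

text \<open>The half-planes are closed, since circles kissing in \<open>S\<close> both meet their common
  tangent, namely in \<open>S\<close>.\<close>

definition on_opposite_sides :: "(real^2) set \<Rightarrow> (real^2) set \<Rightarrow> (real^2) set \<Rightarrow> bool" where
  "on_opposite_sides L A B \<longleftrightarrow>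
     (\<exists>u b. u \<noteq> 0 \<and> L = {x. u \<bullet> x = b} \<and> A \<subseteq> {x. u \<bullet> x \<le> b} \<and> B \<subseteq> {x. u \<bullet> x \<ge> b})"

text \<open>The tangent to a circle in a given point is unique, so the line \<open>L\<close> below is
  \<^emph>\<open>the\<close> common tangent in \<open>S\<close>.\<close>

definition kissing :: "(real^2) set \<Rightarrow> (real^2) set \<Rightarrow> real^2 \<Rightarrow> bool" where
  "kissing c c' S \<longleftrightarrow> c \<inter> c' = {S} \<and>
     (\<exists>L. is_tangent L c S \<and> is_tangent L c' S \<and> on_opposite_sides L c c')"

text \<open>Only meaningful if \<open>P\<close> lies on a circle that kisses \<open>c'\<close> in \<open>S\<close>; in that case
  the description is satisfied by exactly one point. For \<open>P \<noteq> S\<close> the line \<open>PS\<close> is the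
  affine hull of \<open>{P, S}\<close>.\<close>

definition pass_kissing_point :: "(real^2) set \<Rightarrow> real^2 \<Rightarrow> real^2 \<Rightarrow> real^2" where
  "pass_kissing_point c' S P =
     (if P = S then S else (THE P'. P' \<noteq> S \<and> P' \<in> affine hull {P, S} \<inter> c'))"

definition is_diameter :: "real^2 \<Rightarrow> real^2 \<Rightarrow> (real^2) set \<Rightarrow> bool" where
  "is_diameter A B c \<longleftrightarrow>
     (\<exists>a r. r > 0 \<and> c = sphere a r \<and> A \<in> c \<and> B \<in> c \<and> a \<in> closed_segment A B)"

end

theory Submission imports Defs begin

text \<open>If circles with centres \<open>a\<close>, \<open>a'\<close> and radii \<open>r\<close>, \<open>r'\<close> kiss in \<open>S\<close>, then the homothety
  with centre \<open>S\<close> and ratio \<open>- r' / r\<close> maps one to the other, and passing through \<open>S\<close> is exactly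
  this homothety. Hence it maps \<open>a + r v\<close>, for a unit vector \<open>v\<close>, to \<open>a' - r' v\<close>: each passage
  just flips the sign of the unit direction in which the point is seen from the centre of its
  circle. After \<open>n\<close> passages we are at \<open>a\<^sub>1 + (-1)\<^sup>n r\<^sub>1 v\<close>.\<close>

text \<open>Comparing \<open>S\<close> with the extreme point \<open>a + r *\<^sub>R sgn u\<close>
  of the sphere gives equality in Cauchy-Schwarz for \<open>u\<close> and \<open>S - a\<close>, so
  these vectors are parallel.\<close>

lemma sphere_in_halfspace_touching:
  fixes u :: "'a::real_inner"
  assumes "0 < r" "u \<noteq> 0" "S \<in> sphere a r" "\<And>x. x \<in> sphere a r \<Longrightarrow> u \<bullet> x \<le> u \<bullet> S"
  shows "S = a + r *\<^sub>R sgn u"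
proof -
  have "a + r *\<^sub>R sgn u \<in> sphere a r"
    using assms(1,2) by (simp add: dist_norm norm_sgn)
  then have "u \<bullet> (a + r *\<^sub>R sgn u) \<le> u \<bullet> S" by (rule assms(4))
  moreover have "u \<bullet> sgn u = norm u"
    using assms(2) by (simp add: sgn_div_norm divide_simps dot_square_norm power2_eq_square)
  moreover have nS: "norm (S - a) = r"
    using assms(3) by (simp add: dist_norm norm_minus_commute)
  ultimately have "norm u * norm (S - a) \<le> u \<bullet> (S - a)"
    by (simp add: inner_simps mult.commute)
  then have "u \<bullet> (S - a) = norm u * norm (S - a)"
    using norm_cauchy_schwarz[of u "S - a"] by linarith
  then have "norm u *\<^sub>R (S - a) = r *\<^sub>R u"
    using norm_cauchy_schwarz_eq[of u "S - a"] nS by simp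
  then have "inverse (norm u) *\<^sub>R (norm u *\<^sub>R (S - a)) = r *\<^sub>R sgn u"
    by (simp add: sgn_div_norm)
  then have "S - a = r *\<^sub>R sgn u" using assms(2) by simp
  then show ?thesis by (simp add: algebra_simps)
qed

text \<open>A normal of the common tangent, once normalised, serves as \<open>w\<close>: since the
  circles lie on opposite sides, the radii to \<open>S\<close> point in opposite directions.\<close>

lemma kissing_direction:
  assumes "kissing (sphere a r) (sphere a' r') S" "0 < r" "0 < r'"
  obtains w where "norm w = 1" "S = a + r *\<^sub>R w" "S = a' - r' *\<^sub>R w"
proof -
  obtain L where L: "L \<inter> sphere a r = {S}"
      "on_opposite_sides L (sphere a r) (sphere a' r')"
    using assms(1) unfolding kissing_def is_tangent_def by auto
  obtain u b where u: "u \<noteq> 0" "L = {x. u \<bullet> x = b}"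
      "sphere a r \<subseteq> {x. u \<bullet> x \<le> b}" "sphere a' r' \<subseteq> {x. u \<bullet> x \<ge> b}"
    using L(2) unfolding on_opposite_sides_def by auto
  have "S \<in> L" using L(1) by auto
  then have ub: "u \<noteq> 0" "u \<bullet> S = b"
      "\<And>x. x \<in> sphere a r \<Longrightarrow> u \<bullet> x \<le> b" "\<And>x. x \<in> sphere a' r' \<Longrightarrow> u \<bullet> x \<ge> b"
    using u by auto
  have "sphere a r \<inter> sphere a' r' = {S}" using assms(1) unfolding kissing_def by simp
  then have S: "S \<in> sphere a r" "S \<in> sphere a' r'" by auto
  have "S = a + r *\<^sub>R sgn u"
    using sphere_in_halfspace_touching[OF assms(2) ub(1) S(1)] ub by simp
  \<comment> \<open>The second circle lies in the other half-plane, so the touching lemma applies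
    with the reversed normal.\<close>
  moreover have "S = a' + r' *\<^sub>R sgn (- u)"
  proof (rule sphere_in_halfspace_touching)
    show "- u \<bullet> x \<le> - u \<bullet> S" if "x \<in> sphere a' r'" for x
      using that ub(2,4) by auto
  qed (use assms(3) ub(1) S(2) in auto)
  then have "S = a' - r' *\<^sub>R sgn u" by (simp add: sgn_minus)
  ultimately show ?thesis using ub(1) that[of "sgn u"] by (simp add: norm_sgn)
qed

text \<open>The line through the given point and \<open>S\<close> has direction
  \<open>w - v\<close>. Substituting \<open>S + t *\<^sub>R (w - v)\<close> into the equation of the
  second circle gives a quadratic in \<open>t\<close> with roots \<open>0\<close>, which is
  \<open>S\<close>, and \<open>r'\<close>.\<close>

lemma pass_kissing_point_sphere:
  assumes "kissing (sphere a r) (sphere a' r') S" "0 < r" "0 < r'" "norm v = 1"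
  shows "pass_kissing_point (sphere a' r') S (a + r *\<^sub>R v) = a' - r' *\<^sub>R v"
proof -
  obtain w where w: "norm w = 1" "S = a + r *\<^sub>R w" "S = a' - r' *\<^sub>R w"
    using kissing_direction[OF assms(1-3)] .
  let ?P = "a + r *\<^sub>R v" and ?X = "a' - r' *\<^sub>R v"
  show ?thesis
  proof (cases "v = w")
    case True
    then show ?thesis using w by (simp add: pass_kissing_point_def)
  next
    case False
    have PS: "S - ?P = r *\<^sub>R (w - v)" using w(2) by (simp add: algebra_simps)
    have "?P \<noteq> S" using False PS assms(2) by auto
    have XS: "?X = S + r' *\<^sub>R (w - v)" using w(3) by (simp add: algebra_simps)
    have hull: "Y \<in> affine hull {?P, S} \<longleftrightarrow> (\<exists>t. Y = S + t *\<^sub>R (w - v))" for Y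
    proof -
      \<comment> \<open>Swapping the two points makes \<open>S\<close> the base point of the
        parametrisation.\<close>
      have "Y \<in> affine hull {?P, S} \<longleftrightarrow> (\<exists>s. Y = S + s *\<^sub>R (?P - S))"
        by (subst insert_commute) (auto simp: affine_hull_2_alt)
      also have "?P - S = (- r) *\<^sub>R (w - v)" using w(2) by (simp add: algebra_simps)
      also have "(\<exists>s. Y = S + s *\<^sub>R ((- r) *\<^sub>R (w - v))) \<longleftrightarrow> (\<exists>t. Y = S + t *\<^sub>R (w - v))"
      proof (intro iffI; elim exE)
        fix t assume "Y = S + t *\<^sub>R (w - v)"
        then have "Y = S + (- t / r) *\<^sub>R ((- r) *\<^sub>R (w - v))"
          unfolding scaleR_scaleR using assms(2) by simp
        then show "\<exists>s. Y = S + s *\<^sub>R ((- r) *\<^sub>R (w - v))" ..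
      qed (unfold scaleR_scaleR, blast)
      finally show ?thesis .
    qed
    have "(THE Y. Y \<noteq> S \<and> Y \<in> affine hull {?P, S} \<inter> sphere a' r') = ?X"
    proof (rule the_equality)
      have "?X \<in> sphere a' r'" using assms(3,4) by (simp add: dist_norm)
      moreover have "?X \<noteq> S" using XS False assms(3) by auto
      ultimately show "?X \<noteq> S \<and> ?X \<in> affine hull {?P, S} \<inter> sphere a' r'"
        using XS hull by blast
    next
      fix Y assume Y: "Y \<noteq> S \<and> Y \<in> affine hull {?P, S} \<inter> sphere a' r'"
      then obtain t where t: "Y = S + t *\<^sub>R (w - v)" using hull by blast
      have "w \<bullet> w = 1" "v \<bullet> v = 1" using w(1) assms(4) by (simp_all add: dot_square_norm)
      have "t \<noteq> 0" using Y t by auto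
      have "norm (Y - a') = r'" using Y by (simp add: dist_norm norm_minus_commute)
      then have "(Y - a') \<bullet> (Y - a') = r'\<^sup>2" by (simp add: dot_square_norm)
      moreover have "Y - a' = t *\<^sub>R (w - v) - r' *\<^sub>R w" using t w(3) by simp
      ultimately have "(t *\<^sub>R (w - v) - r' *\<^sub>R w) \<bullet> (t *\<^sub>R (w - v) - r' *\<^sub>R w) = r'\<^sup>2" by simp
      then have "2 * (t * (t - r')) * (1 - w \<bullet> v) = 0"
        using \<open>w \<bullet> w = 1\<close> \<open>v \<bullet> v = 1\<close>
        by (simp add: inner_simps inner_commute[of v w] power2_eq_square algebra_simps)
      \<comment> \<open>The last factor of the quadratic is half the squared length of
        \<open>w - v\<close>, hence nonzero; as \<open>t = 0\<close> is excluded, only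
        \<open>t = r'\<close> remains.\<close>
      moreover have "(w - v) \<bullet> (w - v) = 2 * (1 - w \<bullet> v)"
        using \<open>w \<bullet> w = 1\<close> \<open>v \<bullet> v = 1\<close>
        by (simp add: inner_simps inner_commute[of v w])
      then have "1 - w \<bullet> v \<noteq> 0" using False by auto
      ultimately have "t = r'" using \<open>t \<noteq> 0\<close> by simp
      then show "Y = ?X" using t XS by simp
    qed
    then show ?thesis using \<open>?P \<noteq> S\<close> by (simp add: pass_kissing_point_def)
  qed
qed

theorem theorem4:
  fixes n :: nat
    and c :: "nat \<Rightarrow> (real^2) set"
    and S P :: "nat \<Rightarrow> real^2"
    and Q :: "real^2"
  assumes "n \<ge> 1"
    and "\<forall>i\<in>{1..n}. is_circle (c i)"
    and "\<forall>i\<in>{1..<n}. kissing (c i) (c (i + 1)) (S i)"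
    and "kissing (c n) (c 1) (S n)"
    and "P 1 \<in> c 1"
    and "\<forall>i\<in>{1..<n}. P (i + 1) = pass_kissing_point (c (i + 1)) (S i) (P i)"
    and "Q = pass_kissing_point (c 1) (S n) (P n)"
  shows "(even n \<longrightarrow> Q = P 1) \<and> (odd n \<longrightarrow> is_diameter Q (P 1) (c 1))"
proof -
  obtain a r where ar: "\<And>i. i \<in> {1..n} \<Longrightarrow> 0 < r i \<and> c i = sphere (a i) (r i)"
    using assms(2) unfolding is_circle_def by metis
  define v where "v = (1 / r 1) *\<^sub>R (P 1 - a 1)"
  have r1: "0 < r 1" and c1: "c 1 = sphere (a 1) (r 1)" using ar[of 1] assms(1) by auto
  have P1: "P 1 = a 1 + r 1 *\<^sub>R v" using r1 by (simp add: v_def)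
  have "norm v = 1"
    using assms(5) r1 c1 by (simp add: v_def dist_norm norm_minus_commute)
  then have nv: "norm ((- 1) ^ k *\<^sub>R v) = 1" for k by (simp add: power_abs)
  \<comment> \<open>The point with index \<open>Suc k\<close> has undergone \<open>k\<close>
    passages, hence \<open>k\<close> sign flips.\<close>
  have P: "P (Suc k) = a (Suc k) + r (Suc k) *\<^sub>R ((- 1) ^ k *\<^sub>R v)" if "Suc k \<le> n" for k
    using that
  proof (induction k)
    case 0
    then show ?case using P1 by simp
  next
    case (Suc k)
    have k: "Suc k \<in> {1..<n}" "Suc k \<in> {1..n}" "Suc (Suc k) \<in> {1..n}" using Suc.prems by auto
    have "kissing (sphere (a (Suc k)) (r (Suc k))) (sphere (a (Suc (Suc k))) (r (Suc (Suc k)))) (S (Suc k))"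
      using assms(3) k ar by fastforce
    then have "pass_kissing_point (sphere (a (Suc (Suc k))) (r (Suc (Suc k)))) (S (Suc k)) (P (Suc k))
        = a (Suc (Suc k)) - r (Suc (Suc k)) *\<^sub>R ((- 1) ^ k *\<^sub>R v)"
      using pass_kissing_point_sphere[OF _ _ _ nv] Suc ar k by simp
    then show ?case using assms(6) k ar by fastforce
  qed
  obtain m where m: "n = Suc m" using assms(1) by (cases n) auto
  have "kissing (sphere (a n) (r n)) (sphere (a 1) (r 1)) (S n)"
    using assms(1,4) ar[of n] c1 by simp
  then have "Q = a 1 - r 1 *\<^sub>R ((- 1) ^ m *\<^sub>R v)"
    using pass_kissing_point_sphere[OF _ _ r1 nv] P[of m] ar[of n] m assms(7) c1 by simp
  \<comment> \<open>The minus sign of the closing passage turns the exponent \<open>m\<close> into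
    \<open>n\<close>.\<close>
  then have Q: "Q = a 1 + (r 1 * (- 1) ^ n) *\<^sub>R v" using m by simp
  have "is_diameter Q (P 1) (c 1)" if "odd n"
  proof -
    have Q': "Q = a 1 - r 1 *\<^sub>R v" using Q that by simp
    have "Q \<in> c 1" using Q' c1 r1 \<open>norm v = 1\<close> by (simp add: dist_norm)
    \<comment> \<open>The two points are seen from the centre in the opposite directions
      \<open>- v\<close> and \<open>v\<close>, at equal distance.\<close>
    moreover have "a 1 = midpoint Q (P 1)"
      using Q' P1 by (simp add: midpoint_def scaleR_2[symmetric])
    then have "a 1 \<in> closed_segment Q (P 1)" by simp
    ultimately show ?thesis using assms(5) r1 c1 unfolding is_diameter_def by blast
  qed
  moreover have "Q = P 1" if "even n" using Q P1 that by simp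
  ultimately show ?thesis by blast
qed

end
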